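(* Let $\eta$ be a finite Borel measure on $[0,1)$. For every integer $n\ge1$, $$\gamma_\eta(n)=2(n+1)\,\eta([0,1))-4n(n+1)\int_0^1 F_\eta(r)\,r^{2n-1}\,\mathrm{d}r,$$ and $$\gamma_\eta(n)=2n(n+1)\int_0^1\varkappa_\eta(r)\,r^{2n-1}(1-r^2)\,\mathrm{d}r.$$ Moreover, $$\gamma_\eta(0)=2\,\eta([0,1))=2F_\eta(1)=\varkappa_\eta(0).$$
   Context: Measures are positive. For a finite Borel measure $\eta$ on $[0,1)$, extended to a measure on $\mathbb{R}$ by assigning measure zero to the complement of $[0,1)$: $F_\eta(u)=\eta((-\infty,u])$ for $u\in\mathbb{R}$ is its distribution function; $\varkappa_\eta(r)=\frac{2\,\eta([r,1))}{1-r^2}$ for $r\in[0,1)$; and $\gamma_\eta(k)=2(k+1)\int_{[0,1)}r^{2k}\,\mathrm{d}\eta(r)$ for $k\in\{0,1,2,\ldots\}$ (with $0^0=1$). *)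

theory Defs
  imports "HOL-Probability.Distribution_Functions"
begin

text \<open>
  A finite Borel measure on $[0,1)$ is a measure \<open>\<eta> :: real measure\<close> with
  \<open>sets \<eta> = sets (restrict_space borel {0..<1})\<close> and \<open>finite_measure \<eta>\<close>; its
  space is then \<open>{0..<1}\<close>.  Its extension by zero to the whole real line is the
  image measure under the inclusion.
\<close>

definition zero_extension :: "real measure \<Rightarrow> real measure" where
  "zero_extension \<eta> = distr \<eta> borel (\<lambda>x. x)"

lemma emeasure_zero_extension:
  assumes "sets \<eta> = sets (restrict_space borel {0..<1::real})" and "A \<in> sets borel"
  shows "emeasure (zero_extension \<eta>) A = emeasure \<eta> (A \<inter> {0..<1})"
proof -
  have "space \<eta> = {0..<1}"
    using sets_eq_imp_space_eq[OF assms(1)] by (simp add: space_restrict_space)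
  moreover have "(\<lambda>x. x) \<in> measurable \<eta> borel"
    by (subst measurable_cong_sets[OF assms(1) refl]) (simp add: measurable_restrict_space1)
  ultimately show ?thesis
    by (simp add: zero_extension_def emeasure_distr assms(2))
qed

definition F :: "real measure \<Rightarrow> real \<Rightarrow> real" where
  "F \<eta> = cdf (zero_extension \<eta>)"

text \<open>Only the values at \<open>r \<in> {0..<1}\<close> are meaningful.\<close>

definition kappa :: "real measure \<Rightarrow> real \<Rightarrow> real" where
  "kappa \<eta> r = 2 * measure \<eta> {r..<1} / (1 - r\<^sup>2)"

definition gamma :: "real measure \<Rightarrow> nat \<Rightarrow> real" where
  "gamma \<eta> k = 2 * (real k + 1) * (\<integral>r. r ^ (2 * k) \<partial>\<eta>)"

end

theory Submission
  imports Defs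
begin

text \<open>
  For \<open>x\<close> in the unit interval, \<open>x ^ (2n)\<close> is the integral of \<open>2n r ^ (2n - 1)\<close> over \<open>r \<le> x\<close>,
  and \<open>1 - x ^ (2n)\<close> is its integral over \<open>x \<le> r \<le> 1\<close>.  Integrating against \<open>\<eta>\<close> and exchanging
  the integrals turns the first identity into the \<open>\<kappa>\<close>-formula and the second into the
  \<open>F\<close>-formula.
\<close>

text \<open>This is Fubini for the kernel \<open>indicator A (x, y) * g y\<close>: it is dominated
  by \<open>g\<close> in \<open>y\<close> alone, and finiteness of \<open>M\<close> makes that bound
  integrable on the product. After the exchange \<open>g y\<close> leaves the inner integral, and
  the indicator contributes the mass of a slice.\<close>

lemma integral_indicator_slices:
  fixes g :: "'b \<Rightarrow> real"
  assumes "finite_measure M" and "sigma_finite_measure N"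
    and A [measurable]: "A \<in> sets (M \<Otimes>\<^sub>M N)" and g: "integrable N g"
  shows "(\<integral>x. (\<integral>y. indicator A (x, y) * g y \<partial>N) \<partial>M)
       = (\<integral>y. measure M ((\<lambda>x. (x, y)) -` A) * g y \<partial>N)"
proof -
  interpret M: finite_measure M by fact
  interpret N: sigma_finite_measure N by fact
  interpret P: pair_sigma_finite M N ..
  note [measurable] = borel_measurable_integrable[OF g]
  let ?f = "\<lambda>x y. indicator A (x, y) * g y"
  have slice: "integrable N (?f x)" if "x \<in> space M" for x
  proof (rule Bochner_Integration.integrable_bound[OF g])
    show "?f x \<in> borel_measurable N"
      using that by measurable
  qed (auto simp: indicator_def)
  have "integrable (M \<Otimes>\<^sub>M N) (case_prod ?f)"
  proof (rule P.Fubini_integrable)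
    show "integrable M (\<lambda>x. \<integral>y. norm (case (x, y) of (x, y) \<Rightarrow> ?f x y) \<partial>N)"
    \<comment> \<open>The bound does not depend on \<open>x\<close>, so it is a constant, integrable
      over the finite measure \<open>M\<close>.\<close>
    proof (rule M.integrable_const_bound[where B = "\<integral>y. norm (g y) \<partial>N"])
      show "AE x in M. norm (\<integral>y. norm (case (x, y) of (x, y) \<Rightarrow> ?f x y) \<partial>N)
          \<le> (\<integral>y. norm (g y) \<partial>N)"
      proof (intro AE_I2)
        fix x assume "x \<in> space M"
        have "(\<integral>y. norm (?f x y) \<partial>N) \<le> (\<integral>y. norm (g y) \<partial>N)"
          by (intro integral_mono integrable_norm slice g \<open>x \<in> space M\<close>) (simp add: indicator_def)
        then show "norm (\<integral>y. norm (case (x, y) of (x, y) \<Rightarrow> ?f x y) \<partial>N) \<le> (\<integral>y. norm (g y) \<partial>N)"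
          by simp
      qed
    qed measurable
  qed (auto intro: slice)
  then have "(\<integral>x. (\<integral>y. ?f x y \<partial>N) \<partial>M) = (\<integral>y. (\<integral>x. ?f x y \<partial>M) \<partial>N)"
    by (rule P.Fubini_integral[symmetric])
  also have "\<dots> = (\<integral>y. measure M ((\<lambda>x. (x, y)) -` A) * g y \<partial>N)"
  proof (rule Bochner_Integration.integral_cong[OF refl])
    fix y
    have "(\<integral>x. ?f x y \<partial>M) = (\<integral>x. indicator ((\<lambda>x. (x, y)) -` A) x \<partial>M) * g y"
      by (simp add: indicator_vimage[symmetric] indicator_def)
    \<comment> \<open>Integrating an indicator yields the mass of the slice within
      \<open>space M\<close>; slices of a measurable \<open>A\<close> already lie there.\<close>
    also have "(\<lambda>x. (x, y)) -` A \<inter> space M = (\<lambda>x. (x, y)) -` A"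
      using sets.sets_into_space[OF A] by (auto simp: space_pair_measure)
    then have "(\<integral>x. indicator ((\<lambda>x. (x, y)) -` A) x \<partial>M) = measure M ((\<lambda>x. (x, y)) -` A)"
      by simp
    finally show "(\<integral>x. ?f x y \<partial>M) = measure M ((\<lambda>x. (x, y)) -` A) * g y" .
  qed
  finally show ?thesis .
qed

lemma integrable_power_indicator_Icc:
  "integrable lborel (\<lambda>r::real. r ^ k * indicator {a..b} r)"
  using borel_integrable_atLeastAtMost'[of a b "\<lambda>r. r ^ k"]
  by (simp add: set_integrable_def mult.commute continuous_on_power)

context
  fixes \<eta> :: "real measure"
  assumes sets_eta: "sets \<eta> = sets (restrict_space borel {0..<1})"
    and finite_eta: "finite_measure \<eta>"
begin

lemma space_eta: "space \<eta> = {0..<1}"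
  using sets_eq_imp_space_eq[OF sets_eta] by (simp add: space_restrict_space)

lemma measurable_ident_eta [measurable]: "(\<lambda>x. x) \<in> borel_measurable \<eta>"
  by (subst measurable_cong_sets[OF sets_eta refl]) (simp add: measurable_restrict_space1)

lemma integrable_power_eta: "integrable \<eta> (\<lambda>x. x ^ m)"
proof -
  interpret finite_measure \<eta> by (rule finite_eta)
  show ?thesis
    by (rule integrable_const_bound[where B = 1])
      (auto simp: space_eta power_le_one intro!: AE_I2)
qed

text \<open>The intersection matters: \<open>{..r}\<close> itself is not in
  \<open>sets \<eta>\<close>, so its \<open>measure\<close> would be the default 0.\<close>

lemma F_eq_measure: "F \<eta> r = measure \<eta> ({..r} \<inter> {0..<1})"
  by (simp add: F_def cdf_def measure_def emeasure_zero_extension[OF sets_eta])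

lemma moment_eq_tail_integral:
  "(\<integral>x. x ^ Suc k \<partial>\<eta>) = real (Suc k) * (LBINT r=0..1. measure \<eta> {r..<1} * r ^ k)"
proof -
  \<comment> \<open>For fixed \<open>x\<close> this region cuts \<open>{0..1}\<close> down to
    \<open>{0..x}\<close>; for fixed \<open>r\<close> it leaves the tail from \<open>r\<close> on.
    The cut-off to \<open>{0..1}\<close> below makes the weight \<open>r ^ k\<close> integrable over
    \<open>lborel\<close>.\<close>
  let ?A = "{p \<in> space (\<eta> \<Otimes>\<^sub>M lborel). snd p \<le> fst p \<and> 0 \<le> snd p}"
  have A: "?A \<in> sets (\<eta> \<Otimes>\<^sub>M lborel)"
    by measurable
  have "(\<integral>x. x ^ Suc k \<partial>\<eta>) / real (Suc k) = (\<integral>x. x ^ Suc k / real (Suc k) \<partial>\<eta>)"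
    by simp
  also have "\<dots> = (\<integral>x. (\<integral>r. indicator ?A (x, r) * (r ^ k * indicator {0..1} r) \<partial>lborel) \<partial>\<eta>)"
  proof (rule Bochner_Integration.integral_cong[OF refl])
    fix x assume "x \<in> space \<eta>"
    then have x: "0 \<le> x" "x < 1" by (auto simp: space_eta)
    have "x ^ Suc k / real (Suc k) = (\<integral>r. r ^ k * indicator {0..x} r \<partial>lborel)"
      using integral_power[OF x(1), of k] by simp
    also have "\<dots> = (\<integral>r. indicator ?A (x, r) * (r ^ k * indicator {0..1} r) \<partial>lborel)"
      using x by (intro Bochner_Integration.integral_cong)
        (auto simp: indicator_def space_pair_measure space_eta)
    finally show "x ^ Suc k / real (Suc k)
      = (\<integral>r. indicator ?A (x, r) * (r ^ k * indicator {0..1} r) \<partial>lborel)" .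
  qed
  also have "\<dots> = (\<integral>r. measure \<eta> ((\<lambda>x. (x, r)) -` ?A) * (r ^ k * indicator {0..1} r) \<partial>lborel)"
    by (rule integral_indicator_slices[OF finite_eta lborel.sigma_finite_measure_axioms A
          integrable_power_indicator_Icc])
  also have "\<dots> = (\<integral>r. indicator {0..1} r * (measure \<eta> {r..<1} * r ^ k) \<partial>lborel)"
  proof (rule Bochner_Integration.integral_cong[OF refl])
    fix r :: real
    \<comment> \<open>The slice stays inside \<open>{0..<1}\<close>, so it is the tail
      \<open>{r..<1}\<close> only for nonnegative \<open>r\<close>; for negative \<open>r\<close>
      the factor \<open>indicator {0..1} r\<close> annihilates both sides.\<close>
    have "(\<lambda>x. (x, r)) -` ?A = {r..<1}" if "0 \<le> r"
      using that by (auto simp: space_pair_measure space_eta)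
    then show "measure \<eta> ((\<lambda>x. (x, r)) -` ?A) * (r ^ k * indicator {0..1} r)
      = indicator {0..1} r * (measure \<eta> {r..<1} * r ^ k)"
      by (simp add: indicator_def)
  qed
  also have "\<dots> = (LBINT r=0..1. measure \<eta> {r..<1} * r ^ k)"
    using interval_integral_Icc[of 0 1 "\<lambda>r. measure \<eta> {r..<1} * r ^ k"]
    by (simp add: set_lebesgue_integral_def zero_ereal_def one_ereal_def)
  finally show ?thesis
    by (simp add: field_simps)
qed

lemma moment_eq_cdf_integral:
  "(\<integral>x. x ^ Suc k \<partial>\<eta>)
    = measure \<eta> {0..<1} - real (Suc k) * (LBINT r=0..1. F \<eta> r * r ^ k)"
proof -
  interpret finite_measure \<eta> by (rule finite_eta)
  \<comment> \<open>This is the opposite side of the diagonal: the slice in \<open>r\<close> is now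
    \<open>{x..1}\<close>, and the slice in \<open>x\<close> is the part of \<open>{0..<1}\<close>
    up to \<open>r\<close>, whose mass is \<open>F \<eta> r\<close>.\<close>
  let ?A = "{p \<in> space (\<eta> \<Otimes>\<^sub>M lborel). fst p \<le> snd p}"
  have A: "?A \<in> sets (\<eta> \<Otimes>\<^sub>M lborel)"
    by measurable
  have "(measure \<eta> {0..<1} - (\<integral>x. x ^ Suc k \<partial>\<eta>)) / real (Suc k)
      = (\<integral>x. (1 - x ^ Suc k) / real (Suc k) \<partial>\<eta>)"
    \<comment> \<open>Integrability of the power lets the integral of the difference split; the
      constant 1 contributes the total mass.\<close>
    using integrable_power_eta[of "Suc k"] by (simp add: space_eta)
  also have "\<dots> = (\<integral>x. (\<integral>r. indicator ?A (x, r) * (r ^ k * indicator {0..1} r) \<partial>lborel) \<partial>\<eta>)"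
  proof (rule Bochner_Integration.integral_cong[OF refl])
    fix x assume "x \<in> space \<eta>"
    then have x: "0 \<le> x" "x \<le> 1" "x < 1" by (auto simp: space_eta)
    have "(1 - x ^ Suc k) / real (Suc k) = (\<integral>r. r ^ k * indicator {x..1} r \<partial>lborel)"
      using integral_power[OF x(2), of k] by simp
    also have "\<dots> = (\<integral>r. indicator ?A (x, r) * (r ^ k * indicator {0..1} r) \<partial>lborel)"
      using x by (intro Bochner_Integration.integral_cong)
        (auto simp: indicator_def space_pair_measure space_eta)
    finally show "(1 - x ^ Suc k) / real (Suc k)
      = (\<integral>r. indicator ?A (x, r) * (r ^ k * indicator {0..1} r) \<partial>lborel)" .
  qed
  also have "\<dots> = (\<integral>r. measure \<eta> ((\<lambda>x. (x, r)) -` ?A) * (r ^ k * indicator {0..1} r) \<partial>lborel)"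
    by (rule integral_indicator_slices[OF finite_eta lborel.sigma_finite_measure_axioms A
          integrable_power_indicator_Icc])
  also have "\<dots> = (\<integral>r. indicator {0..1} r * (F \<eta> r * r ^ k) \<partial>lborel)"
  proof (rule Bochner_Integration.integral_cong[OF refl])
    fix r :: real
    have "(\<lambda>x. (x, r)) -` ?A = {..r} \<inter> {0..<1}"
      by (auto simp: space_pair_measure space_eta)
    then show "measure \<eta> ((\<lambda>x. (x, r)) -` ?A) * (r ^ k * indicator {0..1} r)
      = indicator {0..1} r * (F \<eta> r * r ^ k)"
      by (simp add: F_eq_measure)
  qed
  also have "\<dots> = (LBINT r=0..1. F \<eta> r * r ^ k)"
    using interval_integral_Icc[of 0 1 "\<lambda>r. F \<eta> r * r ^ k"]
    by (simp add: set_lebesgue_integral_def zero_ereal_def one_ereal_def)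
  finally show ?thesis
    by (simp add: field_simps)
qed

lemma kappa_integral:
  "(LBINT r=0..1. kappa \<eta> r * r ^ k * (1 - r\<^sup>2))
    = 2 * (LBINT r=0..1. measure \<eta> {r..<1} * r ^ k)"
proof -
  have "(LBINT r=0..1. kappa \<eta> r * r ^ k * (1 - r\<^sup>2))
      = (LBINT r=0..1. 2 * (measure \<eta> {r..<1} * r ^ k))"
  \<comment> \<open>Only interior points have to be compared, and there \<open>1 - r\<^sup>2\<close>
    is nonzero and cancels the denominator of \<open>kappa\<close>.\<close>
  proof (rule interval_integral_cong)
    fix r :: real
    assume "r \<in> einterval (min 0 1) (max 0 1)"
    then have "0 < r" "r < 1"
      by (auto simp: einterval_def zero_ereal_def one_ereal_def)
    then have "r\<^sup>2 < 1"
      by (simp add: power_less_one_iff)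
    then show "kappa \<eta> r * r ^ k * (1 - r\<^sup>2) = 2 * (measure \<eta> {r..<1} * r ^ k)"
      by (simp add: kappa_def)
  qed
  then show ?thesis by simp
qed

end

theorem proposition5p6:
  fixes \<eta> :: "real measure"
  assumes "sets \<eta> = sets (restrict_space borel {0..<1})"
    and "finite_measure \<eta>"
  shows "(\<forall>n\<ge>1.
           gamma \<eta> n = 2 * (real n + 1) * measure \<eta> {0..<1}
             - 4 * real n * (real n + 1) * (LBINT r=0..1. F \<eta> r * r ^ (2 * n - 1))
         \<and> gamma \<eta> n = 2 * real n * (real n + 1)
             * (LBINT r=0..1. kappa \<eta> r * r ^ (2 * n - 1) * (1 - r\<^sup>2)))
       \<and> gamma \<eta> 0 = 2 * measure \<eta> {0..<1}
       \<and> 2 * measure \<eta> {0..<1} = 2 * F \<eta> 1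
       \<and> 2 * F \<eta> 1 = kappa \<eta> 0"
proof (intro conjI allI impI)
  fix n :: nat
  assume "n \<ge> 1"
  \<comment> \<open>The moment lemmas are used at \<open>k = 2 * n - 1\<close>;
    \<open>n \<ge> 1\<close> keeps the subtraction on naturals from truncating. The factor
    \<open>Suc k = 2 * n\<close> gives the coefficient \<open>4 * n * (n + 1)\<close>, of which the
    factor 2 in \<open>kappa\<close> absorbs half in the second formula.\<close>
  then have Suc: "Suc (2 * n - 1) = 2 * n" and real: "real (Suc (2 * n - 1)) = 2 * real n"
    by simp_all
  show "gamma \<eta> n = 2 * (real n + 1) * measure \<eta> {0..<1}
      - 4 * real n * (real n + 1) * (LBINT r=0..1. F \<eta> r * r ^ (2 * n - 1))"
    unfolding gamma_def moment_eq_cdf_integral[OF assms, of "2 * n - 1", unfolded Suc real]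
    by (simp add: algebra_simps)
  show "gamma \<eta> n = 2 * real n * (real n + 1)
      * (LBINT r=0..1. kappa \<eta> r * r ^ (2 * n - 1) * (1 - r\<^sup>2))"
    unfolding gamma_def kappa_integral[OF assms]
      moment_eq_tail_integral[OF assms, of "2 * n - 1", unfolded Suc real]
    by (simp add: algebra_simps)
next
  \<comment> \<open>Since \<open>r ^ 0\<close> is 1 even at \<open>r = 0\<close>, the integrand is
    the constant 1.\<close>
  show "gamma \<eta> 0 = 2 * measure \<eta> {0..<1}"
    by (simp add: gamma_def space_eta[OF assms])
next
  \<comment> \<open>All mass lies below 1, so \<open>F \<eta> 1\<close> is the total mass; at 0 the
    tail is everything and the denominator of \<open>kappa\<close> is 1.\<close>
  have "{..1} \<inter> {0..<1} = {0..<1::real}" by auto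
  then show "2 * measure \<eta> {0..<1} = 2 * F \<eta> 1" and "2 * F \<eta> 1 = kappa \<eta> 0"
    by (simp_all add: F_eq_measure[OF assms] kappa_def)
qed

end
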